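(* Let $\mu$ be a measurable function on $\mathbb{C}$ with $|\mu|\leqslant \chi_{\mathbb{D}}$. Then \[ \sigma^2(\mathcal{S}\mu) := \frac{1}{2\pi}\limsup_{R\to1^+}\, \frac{1}{|\log(R-1)|} \int_{0}^{2 \pi} |\mathcal{S} \mu (Re^{i \theta})|^2 \, d\theta \leqslant 1. \]
   Context: $\mathbb{D}$ is the open unit disk and $\chi_{\mathbb{D}}$ its indicator function. The Beurling transform is the principal value integral $\mathcal{S}\mu(z)=-\frac{1}{\pi}\,\mathrm{p.v.}\int_{\mathbb{C}}\frac{\mu(w)}{(z-w)^2}\,dm(w)$, where $m$ is Lebesgue measure on $\mathbb{C}$; for $\mu$ supported in $\overline{\mathbb{D}}$, $\mathcal{S}\mu$ is holomorphic on $\{|z|>1\}$. *)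

theory Defs
  imports "HOL-Analysis.Analysis"
begin

definition beurling :: "(complex \<Rightarrow> complex) \<Rightarrow> complex \<Rightarrow> complex" where
  "beurling mu z =
     - (1 / complex_of_real pi) *
       Lim (at_right (0::real))
         (\<lambda>eps. (LINT w : {w. eps < dist z w} | lebesgue. mu w / (z - w)\<^sup>2))"

end

theory Submission
  imports Defs "HOL-Real_Asymp.Real_Asymp"
begin

text \<open>Write $A_n = \int_{\mathbb{D}} \mu(w) w^n\,dm(w)$. For $|z| > 1$ the Beurling transform is
  $-\frac1\pi \sum_n (n+1) A_n z^{-n-2}$, so by Parseval its mean square on $|z| = R$ is
  $\pi^{-2}\sum_n (n+1)^2 |A_n|^2 R^{-2n-4}$. In $L^2(\mathbb{D}, h\,dm)$ with $h(w) = R^2 - |w|^2$ the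
  monomials $w^n$ are orthogonal with squared norm at most $\pi R^{2n+4}/(n+1)^2$, while
  $\int_{\mathbb{D}} |\mu|^2 / h \le \pi \ln (R^2/(R^2-1))$. Bessel's inequality for $\mu$ in the dual
  weight $1/h$ thus bounds the mean square by $\ln (R^2/(R^2-1)) \sim |\ln (R-1)|$.\<close>

section \<open>Rotation invariance and radial integrals\<close>

lemma nn_integral_lborel_translation:
  fixes g :: "'a::euclidean_space \<Rightarrow> ennreal"
  assumes [measurable]: "g \<in> borel_measurable borel"
  shows "(\<integral>\<^sup>+x. g (x + a) \<partial>lborel) = (\<integral>\<^sup>+x. g x \<partial>lborel)"
proof -
  have "(\<integral>\<^sup>+x. g x \<partial>lborel) = (\<integral>\<^sup>+x. g x \<partial>distr lborel borel ((+) a))"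
    by (simp add: lborel_distr_plus)
  also have "\<dots> = (\<integral>\<^sup>+x. g (x + a) \<partial>lborel)"
    by (simp add: nn_integral_distr add.commute)
  finally show ?thesis ..
qed

text \<open>Uniqueness of Haar measure: with $B$ the unit ball, evaluate
  $\int\int 1_B(x)\, 1_A(x + f y)\,dy\,dx$ in both orders.\<close>

lemma lborel_distr_orthogonal_transformation:
  fixes f :: "'a::euclidean_space \<Rightarrow> 'a"
  assumes f: "orthogonal_transformation f"
  shows "distr lborel borel f = lborel"
proof (rule measure_eqI)
  have lin: "linear f" using f by (rule orthogonal_transformation_linear)
  have [measurable]: "f \<in> borel_measurable borel"
    using lin by (intro borel_measurable_continuous_onI linear_continuous_on)
      (simp add: linear_conv_bounded_linear)
  define g where "g = inv f"
  have fg: "f (g x) = x" for x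
    using orthogonal_transformation_surj[OF f] by (simp add: g_def surj_f_inv_f)
  define B where "B = ball (0::'a) 1"
  have [measurable]: "B \<in> sets borel" by (simp add: B_def)
  \<comment> \<open>As \<open>f\<close> is an isometry with inverse \<open>g\<close>, the distance
    from \<open>x\<close> to \<open>f y\<close> is the distance from \<open>g x\<close> to
    \<open>y\<close>; this moves \<open>f\<close> off the ball.\<close>
  have Bf: "indicator B (x - f y) = (indicator B (y - g x) :: ennreal)" for x y
  proof -
    have "x - f y = f (g x - y)" using lin by (simp add: linear_diff fg)
    then have "norm (x - f y) = norm (y - g x)"
      using f by (simp add: orthogonal_transformation_norm norm_minus_commute)
    then show ?thesis by (simp add: B_def indicator_def norm_minus_commute)
  qed
  fix A assume "A \<in> sets (distr lborel borel f)"
  then have [measurable]: "A \<in> sets borel" by simp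
  have "emeasure lborel B * emeasure (distr lborel borel f) A
      = (\<integral>\<^sup>+x. indicator B x * (\<integral>\<^sup>+y. indicator A (f y) \<partial>lborel) \<partial>lborel)"
    by (subst nn_integral_indicator[symmetric], simp,
        subst nn_integral_distr, simp, simp,
        simp add: nn_integral_multc)
  \<comment> \<open>A shift of the inner variable by \<open>g x\<close> becomes, after applying the
    linear map \<open>f\<close>, a shift by \<open>x\<close>. This couples the two variables before
    the order of integration is exchanged.\<close>
  also have "\<dots> = (\<integral>\<^sup>+x. indicator B x * (\<integral>\<^sup>+y. indicator A (f (y + g x)) \<partial>lborel) \<partial>lborel)"
    by (subst nn_integral_lborel_translation[of "\<lambda>y. indicator A (f y)"]) simp_all
  also have "\<dots> = (\<integral>\<^sup>+x. (\<integral>\<^sup>+y. indicator B x * indicator A (x + f y) \<partial>lborel) \<partial>lborel)"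
    using lin by (simp add: nn_integral_cmult linear_add fg add.commute)
  also have "\<dots> = (\<integral>\<^sup>+y. (\<integral>\<^sup>+x. indicator B x * indicator A (x + f y) \<partial>lborel) \<partial>lborel)"
    by (rule lborel_pair.Fubini') measurable
  also have "\<dots> = (\<integral>\<^sup>+y. (\<integral>\<^sup>+x. indicator B (x - f y) * indicator A x \<partial>lborel) \<partial>lborel)"
  proof (rule nn_integral_cong)
    fix y
    show "(\<integral>\<^sup>+x. indicator B x * indicator A (x + f y) \<partial>lborel) =
          (\<integral>\<^sup>+x. indicator B (x - f y) * indicator A x \<partial>lborel)"
      using nn_integral_lborel_translation[of "\<lambda>x. indicator B (x - f y) * indicator A x" "f y"]
      by simp
  qed
  also have "\<dots> = (\<integral>\<^sup>+x. (\<integral>\<^sup>+y. indicator B (x - f y) * indicator A x \<partial>lborel) \<partial>lborel)"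
    by (rule lborel_pair.Fubini') measurable
  also have "\<dots> = (\<integral>\<^sup>+x. (\<integral>\<^sup>+y. indicator B (y - g x) \<partial>lborel) * indicator A x \<partial>lborel)"
    by (simp add: Bf nn_integral_multc)
  also have "\<dots> = (\<integral>\<^sup>+x. emeasure lborel B * indicator A x \<partial>lborel)"
  proof -
    have "(\<integral>\<^sup>+y. indicator B (y - a) \<partial>lborel) = emeasure lborel B" for a
      using nn_integral_lborel_translation[of "indicator B" "- a"] by simp
    then show ?thesis by simp
  qed
  also have "\<dots> = emeasure lborel B * emeasure lborel A"
    by (simp add: nn_integral_cmult)
  \<comment> \<open>The volume of the unit ball is positive and finite, so it cancels.\<close>
  finally show "emeasure (distr lborel borel f) A = emeasure lborel A"
    using unit_ball_vol_pos[of "real DIM('a)"]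
    by (simp add: ennreal_mult_cancel_left B_def emeasure_ball less_imp_neq[symmetric])
qed simp

text \<open>Rotating the variable preserves the integral \<open>I\<close>, while the hypothesis on
  \<open>g\<close> multiplies it by \<open>k\<close>; hence \<open>I = k * I\<close> with
  \<open>k\<close> different from 1.\<close>

lemma integral_lborel_rotation_eq_0:
  fixes g :: "complex \<Rightarrow> complex"
  assumes [measurable]: "g \<in> borel_measurable borel"
    and c: "cmod c = 1" and k: "k \<noteq> 1" and g: "\<And>w. g (c * w) = k * g w"
  shows "integral\<^sup>L lborel g = 0"
proof -
  have "orthogonal_transformation ((*) c)"
    unfolding orthogonal_transformation using c
    by (auto simp: norm_mult bounded_linear_mult_right bounded_linear.linear)
  then have "integral\<^sup>L lborel g = integral\<^sup>L (distr lborel borel ((*) c)) g"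
    by (simp add: lborel_distr_orthogonal_transformation)
  also have "\<dots> = (LINT w|lborel. g (c * w))"
    by (rule integral_distr) measurable
  also have "\<dots> = k * integral\<^sup>L lborel g"
    by (simp add: g)
  finally show ?thesis using k by simp
qed

section \<open>Distribution of the squared modulus on the disc\<close>

text \<open>A disc of radius r has area pi r^2, so the part of the unit disc where the squared
  modulus exceeds x has area linear in x on [0,1]. This substitutes for polar coordinates when
  radial functions are integrated.\<close>

lemma distr_cmod_power2_disc:
  "distr (restrict_space lborel (ball 0 1)) borel (\<lambda>w::complex. (cmod w)\<^sup>2) =
   density lborel (\<lambda>y. ennreal pi * indicator {0..1} y)"
proof (rule measure_eqI_lessThan)
  let ?M = "restrict_space lborel (ball (0::complex) 1)"
  have meas: "(\<lambda>w. (cmod w)\<^sup>2) \<in> ?M \<rightarrow>\<^sub>M borel"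
    by (intro measurable_restrict_space1) measurable
  have ball: "emeasure lborel (ball (0::complex) r) = ennreal (pi * r\<^sup>2)" if "r \<ge> 0" for r
    using that by (simp add: emeasure_ball eval_unit_ball_vol)
  have cball: "emeasure lborel (cball (0::complex) r) = ennreal (pi * r\<^sup>2)" if "r \<ge> 0" for r
    using that by (simp add: emeasure_cball eval_unit_ball_vol)
  \<comment> \<open>The nested \<open>max\<close> unites three cases: the value is pi for negative
    x, pi (1 - x) on [0,1], and 0 from there on.\<close>
  have left: "emeasure (distr ?M borel (\<lambda>w. (cmod w)\<^sup>2)) {x<..}
      = ennreal (pi * max 0 (1 - max 0 x))" for x
  proof -
    have "emeasure (distr ?M borel (\<lambda>w. (cmod w)\<^sup>2)) {x<..} =
        emeasure ?M ((\<lambda>w. (cmod w)\<^sup>2) -` {x<..} \<inter> ball 0 1)"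
      by (subst emeasure_distr[OF meas]) (auto simp: space_restrict_space)
    also have "\<dots> = emeasure lborel ((\<lambda>w. (cmod w)\<^sup>2) -` {x<..} \<inter> ball 0 1)"
      by (rule emeasure_restrict_space) auto
    also have "\<dots> = ennreal (pi * max 0 (1 - max 0 x))"
    proof -
      consider "x < 0" | "0 \<le> x" "x < 1" | "1 \<le> x" by linarith
      then show ?thesis
      proof cases
        case 1
        then have "(\<lambda>w::complex. (cmod w)\<^sup>2) -` {x<..} \<inter> ball 0 1 = ball 0 1"
          using less_le_trans[OF 1 zero_le_power2] by auto
        then show ?thesis using 1 ball[of 1] by simp
      next
        case 2
        have "x < (cmod w)\<^sup>2 \<longleftrightarrow> sqrt x < cmod w" for w :: complex
          using real_sqrt_less_iff[of x "(cmod w)\<^sup>2"] by simp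
        then have "(\<lambda>w::complex. (cmod w)\<^sup>2) -` {x<..} \<inter> ball 0 1 = ball 0 1 - cball 0 (sqrt x)"
          by auto
        moreover have "cball (0::complex) (sqrt x) \<subseteq> ball 0 1"
          using 2 by (simp add: cball_subset_ball_iff)
        ultimately have "emeasure lborel ((\<lambda>w::complex. (cmod w)\<^sup>2) -` {x<..} \<inter> ball 0 1)
            = emeasure lborel (ball (0::complex) 1) - emeasure lborel (cball (0::complex) (sqrt x))"
          using 2 by (simp add: emeasure_Diff cball)
        then show ?thesis
          using 2 by (simp add: ball cball ennreal_minus algebra_simps)
      next
        case 3
        then have "(\<lambda>w::complex. (cmod w)\<^sup>2) -` {x<..} \<inter> ball 0 1 = {}"
          using power_le_one[of "cmod _" 2] by (force simp: not_less dest: less_imp_le)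
        then show ?thesis using 3 by simp
      qed
    qed
    finally show ?thesis .
  qed
  then show "emeasure (distr ?M borel (\<lambda>w. (cmod w)\<^sup>2)) {x<..} < \<infinity>" for x
    by simp
  show "emeasure (distr ?M borel (\<lambda>w. (cmod w)\<^sup>2)) {x<..} =
      emeasure (density lborel (\<lambda>y. ennreal pi * indicator {0..1} y)) {x<..}" for x
  proof -
    have "emeasure (density lborel (\<lambda>y. ennreal pi * indicator {0..1} y)) {x<..}
       = (\<integral>\<^sup>+y. ennreal pi * indicator ({0..1} \<inter> {x<..}) y \<partial>lborel)"
      by (subst emeasure_density) (auto intro!: nn_integral_cong split: split_indicator)
    also have "\<dots> = ennreal pi * emeasure lborel ({0..1} \<inter> {x<..})"
      by (simp add: nn_integral_cmult)
    also have "{0..1} \<inter> {x<..} = (if x < 0 then {0..1} else {x<..1})"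
      by auto
    also have "ennreal pi * emeasure lborel \<dots> = ennreal (pi * max 0 (1 - max 0 x))"
      by (auto simp: ennreal_mult' max_def)
    finally show ?thesis by (simp add: left)
  qed
qed auto

section \<open>Weighted integrals over the disc\<close>

text \<open>The completed measure is taken because \<open>mu\<close> is only Lebesgue
  measurable.\<close>

abbreviation disc_measure :: "complex measure" where
  "disc_measure \<equiv> lebesgue_on (ball 0 1)"

lemma finite_measure_disc: "finite_measure disc_measure"
  by (rule finite_measure_lebesgue_on) (simp add: lmeasurable_ball)

lemma measure_disc: "measure disc_measure (space disc_measure) = pi"
  by (simp add: measure_restrict_space content_ball eval_unit_ball_vol)

text \<open>Carries Borel integrands over to \<open>lborel\<close>, where the rotation argument and
  the distribution of the squared modulus are available.\<close>

lemma integral_disc_measure_borel: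
  fixes g :: "complex \<Rightarrow> 'a::{banach, second_countable_topology}"
  assumes [measurable]: "g \<in> borel_measurable borel"
  shows "integral\<^sup>L disc_measure g = (LINT w:ball 0 1|lborel. g w)"
proof -
  have "integral\<^sup>L disc_measure g = (LINT w|lebesgue. indicator (ball 0 1) w *\<^sub>R g w)"
    by (rule integral_restrict_space) auto
  also have "\<dots> = (LINT w:ball 0 1|lborel. g w)"
    unfolding set_lebesgue_integral_def
    by (rule integral_completion) (intro borel_measurable_scaleR borel_measurable_indicator; simp)
  finally show ?thesis .
qed

lemma integral_disc_radial:
  fixes \<phi> :: "real \<Rightarrow> real"
  assumes [measurable]: "\<phi> \<in> borel_measurable borel"
  shows "(LINT w|disc_measure. \<phi> ((cmod w)\<^sup>2)) = pi * (LBINT y:{0..1}. \<phi> y)"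
proof -
  have "(LINT w|disc_measure. \<phi> ((cmod w)\<^sup>2)) = (LINT w:ball 0 1|lborel. \<phi> ((cmod w)\<^sup>2))"
    by (rule integral_disc_measure_borel) measurable
  also have "\<dots> = (LINT w|restrict_space lborel (ball 0 1). \<phi> ((cmod w)\<^sup>2))"
    unfolding set_lebesgue_integral_def by (rule integral_restrict_space[symmetric]) auto
  also have "\<dots> = (LINT y|distr (restrict_space lborel (ball 0 1)) borel (\<lambda>w::complex. (cmod w)\<^sup>2). \<phi> y)"
    by (rule integral_distr[symmetric]) (auto intro: measurable_restrict_space1)
  also have "\<dots> = (LINT y|density lborel (\<lambda>y. ennreal (pi * indicator {0..1} y)). \<phi> y)"
    by (simp add: distr_cmod_power2_disc ennreal_mult' ennreal_indicator)
  also have "\<dots> = (LBINT y. (pi * indicator {0..1} y) *\<^sub>R \<phi> y)"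
    by (rule integral_density) auto
  also have "\<dots> = pi * (LBINT y:{0..1}. \<phi> y)"
    by (simp add: set_lebesgue_integral_def mult.assoc)
  finally show ?thesis .
qed

text \<open>With y the squared modulus, the integrand is 1/(R^2 - y) on [0,1], whose pole R^2 lies
  to the right of the interval.\<close>

lemma integral_disc_inverse_weight:
  assumes "R > 1"
  shows "(LINT w|disc_measure. 1 / (R\<^sup>2 - (cmod w)\<^sup>2)) = pi * ln (R\<^sup>2 / (R\<^sup>2 - 1))"
proof -
  have R: "R\<^sup>2 > 1" using assms by (simp add: one_less_power)
  have "(LBINT y. indicator {0..1} y *\<^sub>R (1 / (R\<^sup>2 - y))) = - ln (R\<^sup>2 - 1) - (- ln (R\<^sup>2 - 0))"
  proof (rule integral_FTC_Icc[where F = "\<lambda>y. - ln (R\<^sup>2 - y)"])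
    fix y :: real assume "0 \<le> y" "y \<le> 1"
    then have "((\<lambda>y. - ln (R\<^sup>2 - y)) has_real_derivative 1 / (R\<^sup>2 - y)) (at y within {0..1})"
      using R by (auto intro!: derivative_eq_intros)
    then show "((\<lambda>y. - ln (R\<^sup>2 - y)) has_vector_derivative 1 / (R\<^sup>2 - y)) (at y within {0..1})"
      by (rule has_real_derivative_iff_has_vector_derivative[THEN iffD1])
  next
    show "continuous_on {0..1} (\<lambda>y. 1 / (R\<^sup>2 - y))"
      using R by (intro continuous_intros) auto
  qed simp
  then show ?thesis using R
    by (subst integral_disc_radial[of "\<lambda>y. 1 / (R\<^sup>2 - y)"])
      (auto simp: set_lebesgue_integral_def ln_div)
qed

lemma integral_disc_weighted_power_le:
  assumes "R > 1"
  shows "(LINT w|disc_measure. (cmod (w ^ n))\<^sup>2 * (R\<^sup>2 - (cmod w)\<^sup>2))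
      \<le> pi * R ^ (2 * n + 4) / (real n + 1)\<^sup>2"
proof -
  have R: "R\<^sup>2 > 1" using assms by (simp add: one_less_power)
  \<comment> \<open>An antiderivative of the radial integrand y^n (R^2 - y).\<close>
  define G where "G y = R\<^sup>2 * y ^ Suc n / Suc n - y ^ Suc (Suc n) / Suc (Suc n)" for y
  have G': "(G has_real_derivative y ^ n * (R\<^sup>2 - y)) (at y within A)" for y A
    unfolding G_def
    by (auto intro!: derivative_eq_intros simp del: power_Suc of_nat_Suc) (simp add: algebra_simps)
  have "(LINT w|disc_measure. (cmod (w ^ n))\<^sup>2 * (R\<^sup>2 - (cmod w)\<^sup>2))
      = pi * (LBINT y:{0..1}. y ^ n * (R\<^sup>2 - y))"
    by (subst integral_disc_radial[symmetric]) (simp_all add: norm_power mult.commute flip: power_mult)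
  also have "(LBINT y:{0..1}. y ^ n * (R\<^sup>2 - y)) = G 1 - G 0"
  proof -
    have "(G has_vector_derivative y ^ n * (R\<^sup>2 - y)) (at y within {0..1})" for y
      using G' by (rule has_real_derivative_iff_has_vector_derivative[THEN iffD1])
    moreover have "continuous_on {0..1} (\<lambda>y. y ^ n * (R\<^sup>2 - y))"
      by (intro continuous_intros)
    ultimately show ?thesis
      unfolding set_lebesgue_integral_def by (intro integral_FTC_Icc) auto
  qed
  \<comment> \<open>The integrand stays nonnegative up to y = R^2, so the interval [0,1] may be
    enlarged to [0,R^2], where the integral has a simple closed form.\<close>
  also have "G 1 - G 0 \<le> G (R\<^sup>2) - G 0"
  proof -
    have "G 1 \<le> G (R\<^sup>2)"
    proof (rule DERIV_nonneg_imp_nondecreasing[where f = G])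
      fix y assume "1 \<le> y" "y \<le> R\<^sup>2"
      then show "\<exists>d. (G has_real_derivative d) (at y) \<and> 0 \<le> d"
        using G'[of y UNIV] by (intro exI[of _ "y ^ n * (R\<^sup>2 - y)"]) simp
    qed (use R in simp)
    then show ?thesis by simp
  qed
  also have "\<dots> = R ^ (2 * n + 4) / ((real n + 1) * (real n + 2))"
  proof -
    have "(R\<^sup>2) ^ Suc (Suc n) = R ^ (2 * Suc (Suc n))"
      by (rule power_mult[symmetric])
    also have "2 * Suc (Suc n) = 2 * n + 4"
      by simp
    finally have "G (R\<^sup>2) = R ^ (2 * n + 4) / real (Suc n) - R ^ (2 * n + 4) / real (Suc (Suc n))"
      unfolding G_def by simp
    also have "\<dots> = R ^ (2 * n + 4) / ((real n + 1) * (real n + 2))"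
      by (simp add: divide_simps) (simp add: algebra_simps)
    finally show ?thesis by (simp add: G_def)
  qed
  \<comment> \<open>Weakening n + 2 to n + 1 produces exactly the reciprocal of the weight (n+1)^2 /
    R^(2n+4) that Parseval gives on the circle.\<close>
  also have "\<dots> \<le> R ^ (2 * n + 4) / (real n + 1)\<^sup>2"
    using assms by (intro divide_left_mono) (auto simp: power2_eq_square)
  finally show ?thesis by simp
qed

text \<open>The weight is radial, so a rotation changes the integrand only by a unimodular factor,
  and for distinct exponents that factor can be made different from 1.\<close>

lemma integral_disc_weighted_orthogonal:
  assumes "n \<noteq> m"
  shows "(LINT w|disc_measure. w ^ n * cnj (w ^ m) * complex_of_real (R\<^sup>2 - (cmod w)\<^sup>2)) = 0"
proof -
  define g where "g w = indicator (ball 0 1) w *\<^sub>R (w ^ n * cnj (w ^ m) * complex_of_real (R\<^sup>2 - (cmod w)\<^sup>2))" for w :: complex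
  have h: "(\<lambda>w. w ^ n * cnj (w ^ m) * complex_of_real (R\<^sup>2 - (cmod w)\<^sup>2)) \<in> borel_measurable borel"
    by (intro borel_measurable_continuous_onI continuous_intros)
  have [measurable]: "g \<in> borel_measurable borel"
    unfolding g_def by (intro borel_measurable_scaleR borel_measurable_indicator h) simp
  \<comment> \<open>The angle is chosen so that rotation by \<open>c\<close> multiplies the
    integrand by exp(i pi) = -1.\<close>
  define c where "c = cis (pi / (real n - real m))"
  have "real n * (pi / (real n - real m)) - real m * (pi / (real n - real m)) = pi"
    using assms by (simp flip: diff_divide_distrib left_diff_distrib)
  then have "c ^ n * cnj c ^ m = -1"
    unfolding c_def cis_cnj Complex.DeMoivre cis_mult by (simp add: cis_pi)
  moreover have "g (c * w) = c ^ n * cnj c ^ m * g w" for w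
    by (simp add: g_def c_def norm_mult power_mult_distrib indicator_def)
  ultimately have "integral\<^sup>L lborel g = 0"
    by (intro integral_lborel_rotation_eq_0[of g c "-1"]) (auto simp: c_def)
  then show ?thesis
    unfolding integral_disc_measure_borel[OF h] set_lebesgue_integral_def g_def .
qed

text \<open>Pythagoras for a finite orthogonal family. It serves twice: for weighted monomials on
  the disc and for inverse powers of z on a circle.\<close>

lemma integral_norm_power2_orthogonal_sum:
  fixes e :: "'i \<Rightarrow> 'a \<Rightarrow> complex"
  assumes "finite I"
    and int: "\<And>i j. i \<in> I \<Longrightarrow> j \<in> I \<Longrightarrow> integrable M (\<lambda>x. e i x * cnj (e j x))"
    and orth: "\<And>i j. i \<in> I \<Longrightarrow> j \<in> I \<Longrightarrow> i \<noteq> j \<Longrightarrow> (LINT x|M. e i x * cnj (e j x)) = 0"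
  shows "(LINT x|M. (cmod (\<Sum>i\<in>I. c i * e i x))\<^sup>2) =
      (\<Sum>i\<in>I. (cmod (c i))\<^sup>2 * (LINT x|M. (cmod (e i x))\<^sup>2))"
proof -
  let ?s = "\<lambda>x. \<Sum>i\<in>I. \<Sum>j\<in>I. (c i * cnj (c j)) * (e i x * cnj (e j x))"
  \<comment> \<open>Over the complex numbers the squared modulus is a product with the conjugate and
    expands into a double sum, of which orthogonality keeps the diagonal.\<close>
  have eq: "complex_of_real ((cmod (\<Sum>i\<in>I. c i * e i x))\<^sup>2) = ?s x" for x
    by (simp add: complex_norm_square sum_product ac_simps flip: of_real_power)
  have "complex_of_real (LINT x|M. (cmod (\<Sum>i\<in>I. c i * e i x))\<^sup>2) = (LINT x|M. ?s x)"
    by (simp flip: eq integral_complex_of_real del: of_real_power)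
  also have "\<dots> = (\<Sum>i\<in>I. \<Sum>j\<in>I. (c i * cnj (c j)) * (LINT x|M. e i x * cnj (e j x)))"
    using int by simp
  also have "\<dots> = (\<Sum>i\<in>I. \<Sum>j\<in>I. if i = j then (c i * cnj (c i)) * (LINT x|M. e i x * cnj (e i x)) else 0)"
    using orth by (intro sum.cong) auto
  also have "\<dots> = (\<Sum>i\<in>I. (c i * cnj (c i)) * (LINT x|M. e i x * cnj (e i x)))"
    using \<open>finite I\<close> by simp
  also have "\<dots> = complex_of_real (\<Sum>i\<in>I. (cmod (c i))\<^sup>2 * (LINT x|M. (cmod (e i x))\<^sup>2))"
    by (simp flip: complex_norm_square integral_complex_of_real of_real_power)
  finally show ?thesis
    by (simp only: of_real_eq_iff)
qed

section \<open>Moments of a bounded function on the disc\<close>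

lemma integrable_disc_bounded:
  fixes f :: "complex \<Rightarrow> 'a::{banach, second_countable_topology}"
  assumes "f \<in> borel_measurable disc_measure"
    and "\<And>w. cmod w < 1 \<Longrightarrow> norm (f w) \<le> b"
  shows "integrable disc_measure f"
  using assms by (intro finite_measure.integrable_const_bound[OF finite_measure_disc, where B = b]) (auto intro!: AE_I2)

lemma measurable_disc_continuous:
  fixes f :: "complex \<Rightarrow> 'a::real_normed_vector"
  assumes "continuous_on UNIV f"
  shows "f \<in> borel_measurable disc_measure"
  using assms borel_measurable_continuous_onI[of f] by (auto intro!: measurable_restrict_space1 measurable_completion)

lemma integrable_disc_continuous:
  fixes f :: "complex \<Rightarrow> 'a::euclidean_space"
  assumes "continuous_on UNIV f"
  shows "integrable disc_measure f"
proof -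
  have "compact (f ` cball 0 1)"
    by (intro compact_continuous_image continuous_on_subset[OF assms]) auto
  then obtain b where "\<And>w. w \<in> cball 0 1 \<Longrightarrow> norm (f w) \<le> b"
    by (meson bounded_iff compact_imp_bounded imageI)
  then show ?thesis
    using measurable_disc_continuous[OF assms] by (intro integrable_disc_bounded[of f b]) auto
qed

section \<open>Moments and the expansion of the Beurling transform outside the disc\<close>

text \<open>Up to the factor -(n+1)/pi, this is the coefficient of z^(-n-2) in the expansion of
  \<open>beurling mu\<close> at infinity.\<close>

definition moment :: "(complex \<Rightarrow> complex) \<Rightarrow> nat \<Rightarrow> complex" where
  "moment mu n = (LINT w|disc_measure. mu w * w ^ n)"

locale disc_coefficient =
  fixes mu :: "complex \<Rightarrow> complex"
  assumes measurable_mu: "mu \<in> borel_measurable lebesgue"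
    and mu_le: "\<And>w. cmod (mu w) \<le> indicator (ball 0 1) w"
begin

lemma mu_le_1: "cmod (mu w) \<le> 1"
  using mu_le[of w] by (rule order_trans) (simp add: indicator_def)

lemma measurable_disc_mu [measurable]: "mu \<in> borel_measurable disc_measure"
  using measurable_mu by (rule measurable_restrict_space1)

lemma integrable_mu_mult:
  assumes "continuous_on UNIV f"
  shows "integrable disc_measure (\<lambda>w. mu w * f w)"
proof (rule Bochner_Integration.integrable_bound)
  show "integrable disc_measure f"
    using assms by (rule integrable_disc_continuous)
  show "(\<lambda>w. mu w * f w) \<in> borel_measurable disc_measure"
    using measurable_disc_continuous[OF assms] by measurable
  show "AE w in disc_measure. norm (mu w * f w) \<le> norm (f w)"
    using mu_le_1 by (auto intro!: AE_I2 mult_left_le_one_le simp: norm_mult)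
qed

text \<open>The trivial bound by the area of the disc; it supplies a summable majorant for the
  expansion on a circle.\<close>

lemma moment_le: "cmod (moment mu n) \<le> pi"
proof -
  have "cmod (moment mu n) \<le> (LINT w|disc_measure. cmod (mu w * w ^ n))"
    unfolding moment_def by (rule integral_norm_bound)
  also have "\<dots> \<le> (LINT w|disc_measure. 1)"
  proof (rule integral_mono)
    show "integrable disc_measure (\<lambda>w. cmod (mu w * w ^ n))"
      by (intro integrable_norm integrable_mu_mult continuous_intros)
    show "integrable disc_measure (\<lambda>w. 1::real)"
      by (intro integrable_disc_continuous continuous_intros)
    fix w assume "w \<in> space disc_measure"
    then show "cmod (mu w * w ^ n) \<le> 1"
      using mu_le_1[of w] by (auto simp: norm_mult norm_power intro!: mult_le_one power_le_one)
  qed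
  also have "\<dots> = pi"
    using measure_disc by simp
  finally show ?thesis .
qed

text \<open>The point \<open>z\<close> has distance at least \<open>cmod z - 1\<close> from the
  disc, so for smaller \<open>eps\<close> the truncation removes only points where \<open>mu\<close>
  vanishes. The principal value is the limit of an eventually constant function.\<close>

lemma beurling_outside:
  assumes "1 < cmod z"
  shows "beurling mu z = - (1 / complex_of_real pi) * (LINT w|disc_measure. mu w / (z - w)\<^sup>2)"
proof -
  let ?f = "\<lambda>eps. (LINT w : {w. eps < dist z w} | lebesgue. mu w / (z - w)\<^sup>2)"
  let ?I = "LINT w|disc_measure. mu w / (z - w)\<^sup>2"
  have "?f eps = ?I" if "eps < cmod z - 1" for eps
  proof -
    have "indicator {w. eps < dist z w} w *\<^sub>R (mu w / (z - w)\<^sup>2) =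
        indicator (ball 0 1) w *\<^sub>R (mu w / (z - w)\<^sup>2)" for w
    proof (cases "cmod w < 1")
      case True
      then have "eps < dist z w"
        using that norm_triangle_ineq2[of z w] by (simp add: dist_norm)
      with True show ?thesis by simp
    next
      case False
      then show ?thesis using mu_le[of w] by simp
    qed
    then have "?f eps = (LINT w|lebesgue. indicator (ball 0 1) w *\<^sub>R (mu w / (z - w)\<^sup>2))"
      unfolding set_lebesgue_integral_def by (intro Bochner_Integration.integral_cong refl)
    then show ?thesis
      by (simp add: integral_restrict_space)
  qed
  then have "\<forall>\<^sub>F eps in at_right 0. ?f eps = ?I"
    using assms by (intro eventually_at_rightI[of 0 "cmod z - 1"]) auto
  then have "(?f \<longlongrightarrow> ?I) (at_right 0)"
    by (rule tendsto_eventually)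
  then have "Lim (at_right 0) ?f = ?I"
    by (intro tendsto_Lim) auto
  then show ?thesis
    by (simp add: beurling_def)
qed

text \<open>Expand 1/(z - w)^2 as the sum of (n+1) w^n / z^(n+2) and integrate term by term against
  \<open>mu\<close>.\<close>

lemma beurling_sums:
  assumes z: "1 < cmod z"
  shows "(\<lambda>n. - (1 / complex_of_real pi) * (of_nat (Suc n) * moment mu n) * inverse (z ^ (n + 2)))
    sums beurling mu z"
proof -
  let ?f = "\<lambda>n w. of_nat (Suc n) * inverse (z ^ (n + 2)) * (mu w * w ^ n)"
  \<comment> \<open>The factor |z|^(-2) < 1 is dropped, leaving the differentiated geometric series
    as majorant.\<close>
  let ?b = "\<lambda>n. of_nat (Suc n) * inverse (cmod z) ^ n :: real"
  have z0: "z \<noteq> 0" using z by auto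
  have sb: "summable ?b"
    using geometric_deriv_sums[of "inverse (cmod z)"] z
    by (intro sums_summable) (simp add: inverse_less_1_iff)
  have int: "integrable disc_measure (?f n)" for n
    by (intro integrable_mult_right integrable_mu_mult continuous_intros)
  have fb: "norm (?f n w) \<le> ?b n" if "cmod w < 1" for n w
  proof -
    have "norm (?f n w) = of_nat (Suc n) * inverse (cmod z) ^ (n + 2) * (cmod (mu w) * cmod w ^ n)"
      by (simp add: norm_mult norm_power norm_inverse power_inverse del: of_nat_Suc)
    also have "\<dots> \<le> of_nat (Suc n) * inverse (cmod z) ^ n * 1"
      using z that mu_le_1[of w]
      by (intro mult_mono mult_le_one power_decreasing) (auto intro!: power_le_one simp: inverse_le_1_iff)
    finally show ?thesis by simp
  qed
  have "(\<lambda>n. integral\<^sup>L disc_measure (?f n)) sums (LINT w|disc_measure. (\<Sum>n. ?f n w))"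
  proof (rule sums_integral[OF int])
    show "AE w in disc_measure. summable (\<lambda>n. norm (?f n w))"
    proof (rule AE_I2)
      fix w assume "w \<in> space disc_measure"
      then have "norm (?f n w) \<le> ?b n" for n
        by (intro fb) simp
      then show "summable (\<lambda>n. norm (?f n w))"
        by (intro summable_comparison_test'[OF sb, of 0]) simp
    qed
    have "norm (LINT w|disc_measure. norm (?f n w)) \<le> pi * ?b n" for n
    proof -
      have "(LINT w|disc_measure. norm (?f n w)) \<le> (LINT w|disc_measure. ?b n)"
      proof (rule integral_mono)
        show "integrable disc_measure (\<lambda>w. norm (?f n w))"
          using int by (rule integrable_norm)
        show "integrable disc_measure (\<lambda>w. ?b n)"
          by (intro integrable_disc_continuous continuous_intros)
      qed (intro fb, simp)
      also have "\<dots> = pi * ?b n"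
        using measure_disc by simp
      finally show ?thesis by simp
    qed
    then show "summable (\<lambda>n. LINT w|disc_measure. norm (?f n w))"
      by (rule summable_comparison_test'[OF summable_mult[OF sb, of pi], of 0])
  qed
  also have "(LINT w|disc_measure. (\<Sum>n. ?f n w)) = (LINT w|disc_measure. mu w / (z - w)\<^sup>2)"
  proof (rule Bochner_Integration.integral_cong)
    fix w assume "w \<in> space disc_measure"
    then have "cmod (w / z) < 1"
      using z by (simp add: norm_divide divide_less_eq)
    \<comment> \<open>The differentiated geometric series at w/z, scaled by mu(w)/z^2.\<close>
    from sums_mult[OF geometric_deriv_sums[OF this], of "mu w / z\<^sup>2"]
    have "(\<lambda>n. ?f n w) sums (mu w / z\<^sup>2 * (1 / (1 - w / z)\<^sup>2))"
      by (simp add: field_simps power_divide power2_eq_square del: of_nat_Suc)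
    also have "mu w / z\<^sup>2 * (1 / (1 - w / z)\<^sup>2) = mu w / (z - w)\<^sup>2"
      using z0 by (simp add: field_simps flip: power_mult_distrib)
    finally show "(\<Sum>n. ?f n w) = mu w / (z - w)\<^sup>2"
      by (rule sums_unique[symmetric])
  qed simp
  finally have "(\<lambda>n. - (1 / complex_of_real pi) * integral\<^sup>L disc_measure (?f n)) sums beurling mu z"
    unfolding beurling_outside[OF z] by (rule sums_mult)
  moreover have "- (1 / complex_of_real pi) * integral\<^sup>L disc_measure (?f n)
      = - (1 / complex_of_real pi) * (of_nat (Suc n) * moment mu n) * inverse (z ^ (n + 2))" for n
    by (simp add: moment_def del: of_nat_Suc)
  ultimately show ?thesis
    by (simp only:)
qed

section \<open>Duality bound for the moments\<close>

text \<open>Pairing $\mu$ with $P = \sum_{n<N} \lambda_n \overline{A_n} w^n$ gives the sum $S$ to be bounded, while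
  $\int |P|^2 h \le \pi S$ by orthogonality; the pointwise bound
  $2|\mu P| \le \pi / h + |P|^2 h / \pi$ then yields $2 S \le \pi \int 1/h + S$.\<close>

lemma moment_bound:
  assumes R: "1 < R"
  shows "(\<Sum>n<N. (real (Suc n))\<^sup>2 / R ^ (2 * n + 4) * (cmod (moment mu n))\<^sup>2)
    \<le> pi\<^sup>2 * ln (R\<^sup>2 / (R\<^sup>2 - 1))"
proof -
  \<comment> \<open>The Parseval weight; pi / \<open>l n\<close> is also the bound for the squared
    norm of w^n in the space with weight \<open>h\<close>.\<close>
  define l where "l n = (real (Suc n))\<^sup>2 / R ^ (2 * n + 4)" for n
  define A where "A = moment mu"
  define S where "S = (\<Sum>n<N. l n * (cmod (A n))\<^sup>2)"
  define h where "h w = R\<^sup>2 - (cmod w)\<^sup>2" for w :: complex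
  define P where "P w = (\<Sum>n<N. complex_of_real (l n) * cnj (A n) * w ^ n)" for w
  have R2: "1\<^sup>2 < R\<^sup>2" using one_less_power[OF R, of 2] by simp
  have l0: "l n \<ge> 0" for n using R by (simp add: l_def)
  have h0: "h w > 0" if "cmod w \<le> 1" for w
    using le_less_trans[OF power_mono[OF that, of 2] R2]
    by (simp add: h_def)
  have hc: "continuous_on UNIV h" unfolding h_def by (intro continuous_intros)
  have Pc: "continuous_on UNIV P" unfolding P_def by (intro continuous_intros)
  have "complex_of_real S = (\<Sum>n<N. complex_of_real (l n) * cnj (A n) * A n)"
    by (simp add: S_def complex_norm_square ac_simps del: of_real_power)
  also have "\<dots> = (LINT w|disc_measure. mu w * P w)"
  proof -
    have "(LINT w|disc_measure. mu w * P w) =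
        (LINT w|disc_measure. (\<Sum>n<N. complex_of_real (l n) * cnj (A n) * (mu w * w ^ n)))"
      by (simp add: P_def sum_distrib_left ac_simps)
    also have "\<dots> = (\<Sum>n<N. complex_of_real (l n) * cnj (A n) * A n)"
      by (subst Bochner_Integration.integral_sum)
        (auto intro!: integrable_mult_right integrable_mu_mult continuous_intros simp: A_def moment_def)
    finally show ?thesis ..
  qed
  finally have S_eq: "complex_of_real S = (LINT w|disc_measure. mu w * P w)" .
  have h_inv: "integrable disc_measure (\<lambda>w. 1 / h w)"
  proof (rule integrable_disc_bounded)
    show "(\<lambda>w. 1 / h w) \<in> borel_measurable disc_measure"
      using measurable_disc_continuous[OF hc] by measurable
    fix w :: complex assume w: "cmod w < 1"
    then have "R\<^sup>2 - 1 \<le> h w"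
      using power_mono[of "cmod w" 1 2] by (simp add: h_def)
    then show "norm (1 / h w) \<le> 1 / (R\<^sup>2 - 1)"
      using R one_less_power[OF R, of 2] by (simp add: frac_le)
  qed
  \<comment> \<open>The square root of the weight is absorbed into the monomials, so that weighted
    orthogonality becomes orthogonality for \<open>disc_measure\<close>.\<close>
  let ?e = "\<lambda>n w. w ^ n * complex_of_real (sqrt (h w))"
  have ee: "?e i w * cnj (?e j w) = w ^ i * cnj (w ^ j) * complex_of_real (R\<^sup>2 - (cmod w)\<^sup>2)"
    if "w \<in> space disc_measure" for i j w
    using h0[of w] that by (simp add: h_def flip: of_real_mult)
  have int: "integrable disc_measure (\<lambda>w. ?e i w * cnj (?e j w))" for i j
    by (rule Bochner_Integration.integrable_cong[OF refl ee, THEN iffD2], assumption)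
      (intro integrable_disc_continuous continuous_intros)
  have orth: "(LINT w|disc_measure. ?e i w * cnj (?e j w)) = 0" if "i \<noteq> j" for i j
    using integral_disc_weighted_orthogonal[OF that, of R]
    by (subst Bochner_Integration.integral_cong[OF refl ee])
  have P2: "(cmod (P w))\<^sup>2 * h w = (cmod (\<Sum>n<N. complex_of_real (l n) * cnj (A n) * ?e n w))\<^sup>2"
    if "w \<in> space disc_measure" for w
  proof -
    have "(\<Sum>n<N. complex_of_real (l n) * cnj (A n) * ?e n w) = P w * complex_of_real (sqrt (h w))"
      by (simp add: P_def sum_distrib_right mult.assoc)
    then show ?thesis using h0[of w] that by (simp add: norm_mult power_mult_distrib)
  qed
  have int_P: "integrable disc_measure (\<lambda>w. (cmod (P w))\<^sup>2 * h w)"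
    by (intro integrable_disc_continuous continuous_intros hc Pc)
  have "(LINT w|disc_measure. (cmod (P w))\<^sup>2 * h w)
      = (LINT w|disc_measure. (cmod (\<Sum>n<N. complex_of_real (l n) * cnj (A n) * ?e n w))\<^sup>2)"
    by (rule Bochner_Integration.integral_cong[OF refl P2])
  also have "\<dots> = (\<Sum>n<N. (cmod (complex_of_real (l n) * cnj (A n)))\<^sup>2 * (LINT w|disc_measure. (cmod (?e n w))\<^sup>2))"
    by (rule integral_norm_power2_orthogonal_sum) (simp, rule int, rule orth)
  also have "\<dots> \<le> (\<Sum>n<N. pi * (l n * (cmod (A n))\<^sup>2))"
  proof (rule sum_mono)
    fix n
    have "(LINT w|disc_measure. (cmod (?e n w))\<^sup>2) = (LINT w|disc_measure. (cmod (w ^ n))\<^sup>2 * (R\<^sup>2 - (cmod w)\<^sup>2))"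
      using h0 by (intro Bochner_Integration.integral_cong refl) (auto simp: norm_mult power_mult_distrib h_def less_imp_le)
    also have "\<dots> \<le> pi * R ^ (2 * n + 4) / (real n + 1)\<^sup>2"
      using R by (rule integral_disc_weighted_power_le)
    also have "\<dots> = pi / l n"
      by (simp add: l_def add.commute)
    finally have "(cmod (complex_of_real (l n) * cnj (A n)))\<^sup>2 * (LINT w|disc_measure. (cmod (?e n w))\<^sup>2)
        \<le> (cmod (complex_of_real (l n) * cnj (A n)))\<^sup>2 * (pi / l n)"
      by (rule mult_left_mono) simp
    also have "\<dots> = pi * (l n * (cmod (A n))\<^sup>2)"
      using l0[of n] by (simp add: norm_mult power_mult_distrib power2_eq_square)
    finally show "(cmod (complex_of_real (l n) * cnj (A n)))\<^sup>2 * (LINT w|disc_measure. (cmod (?e n w))\<^sup>2)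
        \<le> pi * (l n * (cmod (A n))\<^sup>2)" .
  qed
  also have "\<dots> = pi * S"
    by (simp add: S_def sum_distrib_left)
  finally have P_le: "(LINT w|disc_measure. (cmod (P w))\<^sup>2 * h w) \<le> pi * S" .
  have pt: "cmod (mu w * P w) \<le> (pi * (1 / h w) + (1 / pi) * ((cmod (P w))\<^sup>2 * h w)) / 2"
    if "cmod w < 1" for w
  proof -
    have "cmod (mu w * P w) \<le> cmod (P w)"
      using mu_le_1[of w] by (simp add: norm_mult mult_left_le_one_le)
    also have "\<dots> \<le> (pi * (1 / h w) + (1 / pi) * ((cmod (P w))\<^sup>2 * h w)) / 2"
    proof -
      \<comment> \<open>The inequality of arithmetic and geometric means; the constant pi is matched
        to \<open>P_le\<close>, so that the quadratic term integrates to at most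
        \<open>S\<close>.\<close>
      have "0 \<le> (pi - cmod (P w) * h w)\<^sup>2 / (2 * pi * h w)"
        using h0[of w] that by simp
      also have "\<dots> = (pi * (1 / h w) + (1 / pi) * ((cmod (P w))\<^sup>2 * h w)) / 2 - cmod (P w)"
        using h0[of w] that by (simp add: field_simps power2_eq_square)
      finally show ?thesis by simp
    qed
    finally show ?thesis .
  qed
  have "S \<le> cmod (complex_of_real S)" by simp
  also have "\<dots> \<le> (LINT w|disc_measure. cmod (mu w * P w))"
    unfolding S_eq by (rule integral_norm_bound)
  also have "\<dots> \<le> (LINT w|disc_measure. (pi * (1 / h w) + (1 / pi) * ((cmod (P w))\<^sup>2 * h w)) / 2)"
  proof (rule integral_mono)
    show "integrable disc_measure (\<lambda>w. cmod (mu w * P w))"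
      by (intro integrable_norm integrable_mu_mult Pc)
    show "integrable disc_measure (\<lambda>w. (pi * (1 / h w) + (1 / pi) * ((cmod (P w))\<^sup>2 * h w)) / 2)"
      by (intro integrable_divide_zero impI Bochner_Integration.integrable_add integrable_mult_right h_inv int_P)
  qed (intro pt, simp)
  also have "\<dots> = (pi * (LINT w|disc_measure. 1 / h w) + (1 / pi) * (LINT w|disc_measure. (cmod (P w))\<^sup>2 * h w)) / 2"
    by (simp only: integral_divide_zero integral_mult_right_zero
        Bochner_Integration.integral_add[OF integrable_mult_right[OF h_inv] integrable_mult_right[OF int_P]])
  also have "(LINT w|disc_measure. 1 / h w) = pi * ln (R\<^sup>2 / (R\<^sup>2 - 1))"
    unfolding h_def using R by (rule integral_disc_inverse_weight)
  also have "(pi * (pi * ln (R\<^sup>2 / (R\<^sup>2 - 1))) + (1 / pi) * (LINT w|disc_measure. (cmod (P w))\<^sup>2 * h w)) / 2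
     \<le> (pi * (pi * ln (R\<^sup>2 / (R\<^sup>2 - 1))) + (1 / pi) * (pi * S)) / 2"
    using P_le by (intro divide_right_mono add_left_mono mult_left_mono) auto
  \<comment> \<open>The chain bounds \<open>S\<close> by half of pi^2 ln(R^2/(R^2-1)) +
    \<open>S\<close>, and the finite sum \<open>S\<close> is absorbed on the left.\<close>
  finally have "S \<le> pi\<^sup>2 * ln (R\<^sup>2 / (R\<^sup>2 - 1))"
    by (simp add: power2_eq_square field_simps)
  then show ?thesis by (simp only: S_def l_def A_def)
qed

end

section \<open>Mean squares over circles\<close>

text \<open>For nonzero \<open>k\<close> the antiderivative has period 2 pi. The frequency is an
  integer because differences of exponents take both signs.\<close>

lemma has_integral_cis_period:
  "((\<lambda>t. cis (of_int k * t)) has_integral (if k = 0 then 2 * pi else 0)) {0..2*pi}"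
proof (cases "k = 0")
  case True
  then show ?thesis
    using has_integral_const_real[of "1::complex" 0 "2*pi"] by (simp add: scaleR_conv_of_real)
next
  case False
  let ?F = "\<lambda>t. cis (of_int k * t) / (\<i> * of_int k)"
  have "(?F has_vector_derivative cis (of_int k * t)) (at t within {0..2*pi})" for t
  proof -
    have "((\<lambda>z. exp (\<i> * of_int k * z) / (\<i> * of_int k)) has_field_derivative exp (\<i> * of_int k * t))
        (at (complex_of_real t))"
      using False by (auto intro!: derivative_eq_intros)
    from has_vector_derivative_real_field[OF this] show ?thesis
      by (simp add: cis_conv_exp mult.assoc)
  qed
  then have "((\<lambda>t. cis (of_int k * t)) has_integral ?F (2 * pi) - ?F 0) {0..2*pi}"
    by (intro fundamental_theorem_of_calculus) auto
  moreover have "cis (of_int k * (2 * pi)) = 1"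
    using cis_multiple_2pi[of "of_int k"] by (simp add: ac_simps)
  ultimately show ?thesis
    using False by simp
qed

abbreviation period_measure :: "real measure" where
  "period_measure \<equiv> lebesgue_on {0..2*pi}"

lemma integrable_period_continuous:
  fixes f :: "real \<Rightarrow> 'a::euclidean_space"
  assumes "continuous_on {0..2*pi} f"
  shows "integrable period_measure f"
  using assms by (intro continuous_imp_integrable_real)

lemma integral_circle_inverse_power:
  assumes "R > 0"
  shows "(LINT t|period_measure. inverse ((complex_of_real R * cis t) ^ i) * cnj (inverse ((complex_of_real R * cis t) ^ j)))
    = (if i = j then 2 * pi / R ^ (2 * i) else 0)"
proof -
  \<comment> \<open>Inversion reverses the angle and conjugation reverses it again, so the product
    has frequency j - i.\<close>
  let ?k = "int j - int i"
  have eq: "inverse ((complex_of_real R * cis t) ^ i) * cnj (inverse ((complex_of_real R * cis t) ^ j))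
      = inverse (complex_of_real R ^ (i + j)) * cis (of_int ?k * t)" for t
  proof -
    have p: "inverse ((complex_of_real R * cis t) ^ n) = inverse (complex_of_real R ^ n) * cis (- (real n * t))" for n
      by (simp add: power_mult_distrib Complex.DeMoivre cis_inverse)
    show ?thesis
      unfolding p by (simp add: cis_cnj power_add cis_mult left_diff_distrib)
  qed
  have "(LINT t|period_measure. cis (of_int ?k * t)) = (if ?k = 0 then 2 * pi else 0)"
    using has_integral_cis_period[of ?k]
    by (subst lebesgue_integral_eq_integral)
      (auto intro!: integrable_period_continuous continuous_intros simp: scaleR_conv_of_real)
  then show ?thesis
    unfolding eq by (simp add: divide_inverse flip: mult_2)
qed

section \<open>Mean square of the Beurling transform on a circle\<close>

text \<open>Orthogonality and \<open>moment_bound\<close> control every partial sum of the expansion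
  by the same constant; dominated convergence passes this on to the limit.\<close>

lemma (in disc_coefficient) integral_beurling_circle_le:
  assumes R: "1 < R"
  shows "integral {0..2*pi} (\<lambda>t. (cmod (beurling mu (complex_of_real R * cis t)))\<^sup>2)
      \<le> 2 * pi * ln (R\<^sup>2 / (R\<^sup>2 - 1))"
proof -
  let ?z = "\<lambda>t. complex_of_real R * cis t"
  let ?c = "\<lambda>n. - (1 / complex_of_real pi) * (of_nat (Suc n) * moment mu n)"
  let ?e = "\<lambda>n t. inverse (?z t ^ (n + 2))"
  let ?F = "\<lambda>N t. \<Sum>n<N. ?c n * ?e n t"
  let ?b = "\<lambda>n. real (Suc n) * inverse R ^ n"
  have sb: "summable ?b"
    using geometric_deriv_sums[of "inverse R"] R by (intro sums_summable) (simp add: inverse_less_1_iff)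
  have b0: "0 \<le> ?b n" for n using R by simp
  have term_le: "cmod (?c n * ?e n t) \<le> ?b n" for n t
  proof -
    have "cmod (?c n * ?e n t) = (real (Suc n) * inverse R ^ (n + 2)) * (cmod (moment mu n) / pi)"
      using R by (simp add: norm_mult norm_divide norm_inverse norm_power power_inverse del: of_nat_Suc)
    also have "\<dots> \<le> (real (Suc n) * inverse R ^ n) * 1"
      using R moment_le[of n]
      by (intro mult_mono power_decreasing) (auto simp: inverse_le_1_iff)
    finally show ?thesis by simp
  qed
  have F_le: "cmod (?F N t) \<le> suminf ?b" for N t
  proof -
    have "cmod (?F N t) \<le> (\<Sum>n<N. ?b n)"
      using term_le by (intro sum_norm_le)
    also have "\<dots> \<le> suminf ?b"
      using sb b0 by (intro sum_le_suminf) auto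
    finally show ?thesis .
  qed
  have F_lim: "(\<lambda>N. ?F N t) \<longlonglongrightarrow> beurling mu (?z t)" for t
    using beurling_sums[of "?z t"] R by (simp add: sums_def norm_mult)
  have F_cont: "continuous_on A (?F N)" for N A
    using R by (intro continuous_intros) auto
  have F2_lim: "(\<lambda>N. (cmod (?F N t))\<^sup>2) \<longlonglongrightarrow> (cmod (beurling mu (?z t)))\<^sup>2" for t
    by (intro tendsto_intros F_lim)
  have F2_meas: "(\<lambda>t. (cmod (?F N t))\<^sup>2) \<in> borel_measurable period_measure" for N
    by (intro borel_measurable_integrable integrable_period_continuous continuous_intros F_cont)
  have F2_bd: "norm ((cmod (?F N t))\<^sup>2) \<le> (suminf ?b)\<^sup>2" for N t
    using F_le[of t N] by (simp add: power_mono)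
  have w: "integrable period_measure (\<lambda>t. (suminf ?b)\<^sup>2)"
    by (intro integrable_period_continuous continuous_intros)
  \<comment> \<open>Measurability along the circle is inherited from the continuous partial
    sums.\<close>
  have meas: "(\<lambda>t. (cmod (beurling mu (?z t)))\<^sup>2) \<in> borel_measurable period_measure"
    by (rule borel_measurable_LIMSEQ_metric[OF F2_meas F2_lim])
  note dom = meas F2_meas w AE_I2[OF F2_lim] AE_I2[OF F2_bd]
  have int: "integrable period_measure (\<lambda>t. (cmod (beurling mu (?z t)))\<^sup>2)"
    by (rule integrable_dominated_convergence[OF dom])
  have "(LINT t|period_measure. (cmod (?F N t))\<^sup>2) \<le> 2 * pi * ln (R\<^sup>2 / (R\<^sup>2 - 1))" for N
  proof -
    have ee: "(LINT t|period_measure. ?e i t * cnj (?e j t)) = (if i = j then 2 * pi / R ^ (2 * i + 4) else 0)" for i j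
    proof -
      \<comment> \<open>The expansion starts at z^(-2), which shifts the exponents by 2.\<close>
      have "2 * (i + 2) = 2 * i + 4" by simp
      then show ?thesis
        using integral_circle_inverse_power[OF less_trans[OF zero_less_one R], of "i + 2" "j + 2"]
        by (simp only: add_right_cancel)
    qed
    have "complex_of_real (LINT t|period_measure. (cmod (?e n t))\<^sup>2) = 2 * pi / R ^ (2 * n + 4)" for n
      using ee[of n n] by (simp only: integral_complex_of_real[symmetric] complex_norm_square if_True simp_thms)
    then have e2: "(LINT t|period_measure. (cmod (?e n t))\<^sup>2) = 2 * pi / R ^ (2 * n + 4)" for n
      by (simp only: of_real_eq_iff)
    have "(LINT t|period_measure. (cmod (?F N t))\<^sup>2)
        = (\<Sum>n<N. (cmod (?c n))\<^sup>2 * (LINT t|period_measure. (cmod (?e n t))\<^sup>2))"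
    proof (rule integral_norm_power2_orthogonal_sum)
      show "integrable period_measure (\<lambda>t. ?e i t * cnj (?e j t))" for i j
        using R by (intro integrable_period_continuous continuous_intros) auto
    qed (use ee in simp_all)
    \<comment> \<open>The factor 2 / pi is 2 pi from the circle times 1 / pi^2 from the squared
      coefficient.\<close>
    also have "\<dots> = (\<Sum>n<N. (2 / pi) * ((real (Suc n))\<^sup>2 / R ^ (2 * n + 4) * (cmod (moment mu n))\<^sup>2))"
    proof (rule sum.cong[OF refl])
      fix n
      have "(cmod (?c n))\<^sup>2 = (real (Suc n))\<^sup>2 * (cmod (moment mu n))\<^sup>2 / pi\<^sup>2"
        by (simp add: norm_mult norm_divide power_mult_distrib power_divide del: of_nat_Suc)
      then show "(cmod (?c n))\<^sup>2 * (LINT t|period_measure. (cmod (?e n t))\<^sup>2)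
          = (2 / pi) * ((real (Suc n))\<^sup>2 / R ^ (2 * n + 4) * (cmod (moment mu n))\<^sup>2)"
        unfolding e2 by (simp add: power2_eq_square del: of_nat_Suc)
    qed
    also have "\<dots> \<le> (2 / pi) * (pi\<^sup>2 * ln (R\<^sup>2 / (R\<^sup>2 - 1)))"
      unfolding sum_distrib_left[symmetric] by (intro mult_left_mono moment_bound R) simp
    also have "\<dots> = 2 * pi * ln (R\<^sup>2 / (R\<^sup>2 - 1))"
      by (simp add: power2_eq_square)
    finally show ?thesis .
  qed
  then have "(LINT t|period_measure. (cmod (beurling mu (?z t)))\<^sup>2) \<le> 2 * pi * ln (R\<^sup>2 / (R\<^sup>2 - 1))"
    by (intro LIMSEQ_le_const2[OF integral_dominated_convergence[OF dom]]) auto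
  \<comment> \<open>Integrability identifies the Lebesgue integral with the gauge integral in the
    statement.\<close>
  then show ?thesis
    by (simp add: lebesgue_integral_eq_integral[OF int])
qed

section \<open>Passage to the limit superior\<close>

theorem theorem1p1:
  fixes mu :: "complex \<Rightarrow> complex"
  assumes "mu \<in> borel_measurable lebesgue"
    and "\<And>w. cmod (mu w) \<le> indicator (ball 0 1) w"
  shows "Limsup (at_right 1)
           (\<lambda>R::real. ereal ((1 / (2 * pi)) * (1 / \<bar>ln (R - 1)\<bar>) *
              integral {0..2*pi} (\<lambda>\<theta>. (cmod (beurling mu (complex_of_real R * cis \<theta>)))\<^sup>2)))
         \<le> 1"
proof -
  interpret disc_coefficient mu
    using assms by unfold_locales
  let ?I = "\<lambda>R. integral {0..2*pi} (\<lambda>\<theta>. (cmod (beurling mu (complex_of_real R * cis \<theta>)))\<^sup>2)"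
  let ?g = "\<lambda>R::real. ln (R\<^sup>2 / (R\<^sup>2 - 1)) / \<bar>ln (R - 1)\<bar>"
  \<comment> \<open>At R = 2 the logarithm vanishes and both sides are 0 by the convention for
    division by zero.\<close>
  have le: "(1 / (2 * pi)) * (1 / \<bar>ln (R - 1)\<bar>) * ?I R \<le> ?g R" if "1 < R" for R
  proof -
    have "(1 / (2 * pi)) * (1 / \<bar>ln (R - 1)\<bar>) * ?I R
        \<le> (1 / (2 * pi)) * (1 / \<bar>ln (R - 1)\<bar>) * (2 * pi * ln (R\<^sup>2 / (R\<^sup>2 - 1)))"
      using that by (intro mult_left_mono integral_beurling_circle_le) auto
    then show ?thesis by simp
  qed
  have "\<forall>\<^sub>F R in at_right 1. ereal ((1 / (2 * pi)) * (1 / \<bar>ln (R - 1)\<bar>) * ?I R) \<le> ereal (?g R)"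
    unfolding ereal_less_eq by (rule eventually_at_rightI[of 1 2]) (rule le, simp_all)
  then have "Limsup (at_right 1) (\<lambda>R. ereal ((1 / (2 * pi)) * (1 / \<bar>ln (R - 1)\<bar>) * ?I R))
      \<le> Limsup (at_right 1) (\<lambda>R. ereal (?g R))"
    by (rule Limsup_mono)
  also have "\<dots> = ereal 1"
  proof (rule lim_imp_Limsup)
    \<comment> \<open>As R tends to 1, R^2/(R^2-1) behaves like 1/(2(R-1)); the constant 2
      disappears in the quotient of logarithms.\<close>
    have "(?g \<longlongrightarrow> 1) (at_right 1)"
      by real_asymp
    then show "((\<lambda>R. ereal (?g R)) \<longlongrightarrow> ereal 1) (at_right 1)"
      by (rule tendsto_ereal)
  qed simp
  finally show ?thesis
    by (simp add: one_ereal_def)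
qed

end
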